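(* If $A=(A_m)_{m=0}^\infty$ is the Appell sequence determined by $\log f_A(t) = \sum_{k=1}^\infty c_k \frac{t^k}{k!}$, then \[ \mathbb{E}\left(A^2_{\lambda}(x):\lambda\vdash n\right) = \sum_{\lambda \vdash n}\frac{1}{n!}F_\lambda^2 A^2_\lambda(x) = B_n((x+c_1)^2), \] where $B=(B_n)_{n=0}^{\infty}$ is the Appell sequence with $B_1(0)=0$ determined by $\log f_B(t) = \sum_{k=2}^\infty \frac{c_k^2}{(k-1)!} \frac{t^k}{k!}$.
   Context: An Appell sequence is a sequence of polynomials $(A_m)_{m\ge0}$ with $A_0=1$ and $A_m'=mA_{m-1}$ for $m\ge1$; it has exponential generating function $\sum_k A_k(x)t^k/k!=e^{xt}f_A(t)$ for a formal power series $f_A$ with $f_A(0)=1$, and every such $f_A$ determines an Appell sequence. For a partition $\lambda$ of length $r$, let $(n_1,\dots,n_r)=(\lambda_r,\lambda_{r-1}+1,\dots,\lambda_1+r-1)$ and $A_\lambda=\operatorname{Wr}[A_{n_1},\dots,A_{n_r}]/\Delta(n_1,\dots,n_r)$, where $\operatorname{Wr}$ is the Wronskian and $\Delta$ the Vandermonde determinant $\prod_{i<j}(x_j-x_i)$. $F_\lambda$ is the number of standard Young tableaux of shape $\lambda$; the expectation is over Plancherel measure $\mathbb{P}(\lambda)=F_\lambda^2/n!$ on partitions of $n$. *)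

theory Defs
  imports "HOL-Computational_Algebra.Formal_Power_Series"
          "HOL-Computational_Algebra.Polynomial"
          "HOL-Library.FuncSet"
          "Jordan_Normal_Form.Determinant"
begin

text \<open>Exponential of a formal power series g with g(0) = 0: exp(g) = (sum_n t^n/n!) o g.\<close>
definition fps_exp_of :: "'a::field_char_0 fps \<Rightarrow> 'a fps" where
  "fps_exp_of g = fps_compose (fps_exp 1) g"

text \<open>The Appell sequence with exponential generating function e^{xt} f(t):
  A_m(x) = m! [t^m] e^{xt} f(t) = sum_j (m choose j) j! f_j x^(m-j),
  where f = sum_j f_j t^j.\<close>
definition appell :: "'a::field_char_0 fps \<Rightarrow> nat \<Rightarrow> 'a poly" where
  "appell f m = (\<Sum>j\<le>m. monom (of_nat (m choose j) * fact j * fps_nth f j) (m - j))"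

definition wronskian :: "'a::idom poly list \<Rightarrow> 'a poly" where
  "wronskian ps = det (mat (length ps) (length ps) (\<lambda>(i,j). (pderiv ^^ i) (ps ! j)))"

definition vandermonde :: "nat list \<Rightarrow> int" where
  "vandermonde ns = (\<Prod>j<length ns. \<Prod>i<j. int (ns ! j) - int (ns ! i))"

definition partitions :: "nat \<Rightarrow> nat list set" where
  "partitions n = {lam. sorted_wrt (\<ge>) lam \<and> (\<forall>x\<in>set lam. 0 < x) \<and> sum_list lam = n}"

definition shifted_parts :: "nat list \<Rightarrow> nat list" where
  "shifted_parts lam = map (\<lambda>i. lam ! (length lam - 1 - i) + i) [0..<length lam]"

definition appell_schur :: "'a::field_char_0 fps \<Rightarrow> nat list \<Rightarrow> 'a poly" where
  "appell_schur f lam =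
     smult (inverse (of_int (vandermonde (shifted_parts lam))))
       (wronskian (map (appell f) (shifted_parts lam)))"

definition young_cells :: "nat list \<Rightarrow> (nat \<times> nat) set" where
  "young_cells lam = {(i,j). i < length lam \<and> j < lam ! i}"

definition standard_tableaux :: "nat list \<Rightarrow> (nat \<times> nat \<Rightarrow> nat) set" where
  "standard_tableaux lam =
     {T. T \<in> extensional (young_cells lam)
       \<and> bij_betw T (young_cells lam) {1..sum_list lam}
       \<and> (\<forall>i j. (i, Suc j) \<in> young_cells lam \<longrightarrow> T (i,j) < T (i, Suc j))
       \<and> (\<forall>i j. (Suc i, j) \<in> young_cells lam \<longrightarrow> T (i,j) < T (Suc i, j))}"

definition num_syt :: "nat list \<Rightarrow> nat" where
  "num_syt lam = card (standard_tableaux lam)"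

end

theory Submission
  imports Defs
begin

text \<open>
  Put \<open>h\<^sub>k = A\<^sub>k(x) / k!\<close>. Then \<open>\<Sum> h\<^sub>k t\<^sup>k = exp (\<Sum> p\<^sub>k t\<^sup>k / k)\<close> with \<open>p\<^sub>1 = x + c\<^sub>1\<close> and
  \<open>p\<^sub>k = c\<^sub>k / (k - 1)!\<close> otherwise, and the Wronskian is \<open>\<Prod> n\<^sub>j!\<close> times the Jacobi--Trudi determinant
  \<open>s\<^sub>\<lambda> = det (h (n\<^sub>j - i))\<close>. With Frobenius' formula \<open>F\<^sub>\<lambda> = n! \<Delta> / \<Prod> n\<^sub>j!\<close> this gives \<open>F\<^sub>\<lambda> A\<^sub>\<lambda>(x) = n! s\<^sub>\<lambda>\<close>,
  so the claim is Cauchy's identity \<open>\<Sum> s\<^sub>\<lambda>\<^sup>2 t\<^bsup>|\<lambda>|\<^esup> = exp (\<Sum> p\<^sub>k\<^sup>2 t\<^sup>k / k)\<close>.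

  Cauchy's identity is the recursion \<open>n Z\<^sub>n = \<Sum> p\<^sub>k\<^sup>2 Z\<^sub>n\<^sub>-\<^sub>k\<close> for \<open>Z\<^sub>n = \<Sum> s\<^sub>\<lambda>\<^sup>2\<close>. Summing over all
  \<open>r\<close>-tuples of naturals instead of partitions (with \<open>r \<ge> n\<close>, each partition then counted \<open>r!\<close> times),
  write \<open>n s\<^sub>m = \<Sum> p\<^sub>k s(m - k e\<^sub>j)\<close>, substitute \<open>m' = m - k e\<^sub>j\<close> in \<open>\<Sum> s\<^sub>m s(m - k e\<^sub>j)\<close>, and use
  \<open>\<Sum>\<^sub>j s(m' + k e\<^sub>j) = p\<^sub>k s(m')\<close>.
\<close>

subsection \<open>Jacobi--Trudi determinants\<close>

definition shifted_coeff :: "(nat \<Rightarrow> 'a::zero) \<Rightarrow> nat \<Rightarrow> nat \<Rightarrow> 'a" where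
  "shifted_coeff h m i = (if i \<le> m then h (m - i) else 0)"

text \<open>Jacobi--Trudi determinant \<open>det (h (m j - i))\<close>, where \<open>h\<close> vanishes at negative arguments. If \<open>m\<close> lists the
  shifted parts of a partition it is the Schur function in terms of the complete symmetric
  functions \<open>h\<close>; allowing arbitrary \<open>m\<close> makes straightening automatic.\<close>
definition jt :: "nat \<Rightarrow> (nat \<Rightarrow> 'a::comm_ring_1) \<Rightarrow> (nat \<Rightarrow> nat) \<Rightarrow> 'a" where
  "jt r h m = det (mat r r (\<lambda>(j, i). shifted_coeff h (m j) i))"

text \<open>Each summand has one factor per row, so changing a single entry of \<open>m\<close>
  changes a single factor.\<close>

lemma jt_leibniz:
  "jt r h m = (\<Sum>\<sigma> | \<sigma> permutes {..<r}. signof \<sigma> * (\<Prod>j<r. shifted_coeff h (m j) (\<sigma> j)))"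
proof -
  have "jt r h m = (\<Sum>\<sigma> | \<sigma> permutes {0..<r}. signof \<sigma> *
      (\<Prod>j = 0..<r. mat r r (\<lambda>(j, i). shifted_coeff h (m j) i) $$ (j, \<sigma> j)))"
    unfolding jt_def by (rule det_def') simp
  also have "\<dots> = (\<Sum>\<sigma> | \<sigma> permutes {0..<r}. signof \<sigma> *
      (\<Prod>j = 0..<r. shifted_coeff h (m j) (\<sigma> j)))"
    by (intro sum.cong arg_cong2[where f = "(*)"] prod.cong refl index_mat(1)[THEN trans])
      (auto dest: permutes_in_image)
  finally show ?thesis by (simp add: lessThan_atLeast0)
qed

lemma jt_cong: "(\<And>j. j < r \<Longrightarrow> m j = m' j) \<Longrightarrow> jt r h m = jt r h m'"
  by (simp add: jt_leibniz)

lemma jt_permute: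
  assumes "\<sigma> permutes {..<r}"
  shows "jt r h (m \<circ> \<sigma>) = signof \<sigma> * jt r h m"
proof -
  let ?A = "mat r r (\<lambda>(j, i). shifted_coeff h (m j) i)"
  have "det (mat r r (\<lambda>(i, j). ?A $$ (\<sigma> i, j))) = signof \<sigma> * det ?A"
    by (rule det_permute_rows) (use assms in \<open>auto simp: lessThan_atLeast0\<close>)
  moreover have "mat r r (\<lambda>(i, j). ?A $$ (\<sigma> i, j)) = mat r r (\<lambda>(j, i). shifted_coeff h ((m \<circ> \<sigma>) j) i)"
    using permutes_in_image[OF assms] by (intro eq_matI) auto
  ultimately show ?thesis by (simp add: jt_def)
qed

lemma jt_not_inj:
  assumes "\<not> inj_on m {..<r}"
  shows "jt r h m = 0"
proof -
  from assms obtain a b where "a < r" "b < r" "a \<noteq> b" "m a = m b"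
    by (auto simp: inj_on_def)
  then show ?thesis unfolding jt_def
    by (intro det_identical_rows[of _ r a b]) auto
qed

lemma jt_not_inj_upd:
  assumes "b < r" "j < r" "b \<noteq> j" "m b = v"
  shows "jt r h (m(j := v)) = 0"
  using assms by (intro jt_not_inj) (metis fun_upd_other fun_upd_same inj_onD lessThan_iff)

text \<open>The maximum of \<open>q + 1\<close> distinct naturals is at least \<open>q\<close>;
  remove it and induct.\<close>

lemma sum_card_lower_bound:
  assumes "finite S" "card S = q"
  shows "(\<Sum>i<q. i) \<le> \<Sum>(S :: nat set)"
  using assms
proof (induction q arbitrary: S)
  case (Suc q)
  have ne: "S \<noteq> {}" using Suc.prems by auto
  have "Max S \<ge> q"
  proof (rule ccontr)
    assume "\<not> q \<le> Max S"
    then have "S \<subseteq> {..<q}" using Max_ge[OF Suc.prems(1)] by fastforce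
    then have "card S \<le> card {..<q}" by (intro card_mono) auto
    then show False using Suc.prems by simp
  qed
  moreover have "\<Sum>S = Max S + \<Sum>(S - {Max S})"
    using Suc.prems(1) ne by (intro sum.remove) auto
  moreover have "(\<Sum>i<q. i) \<le> \<Sum>(S - {Max S})"
    using Suc.prems ne by (intro Suc.IH) auto
  ultimately show ?case by simp
qed simp

lemma sum_inj_lower_bound:
  assumes "inj_on m {..<r}"
  shows "(\<Sum>i<r. i) \<le> (\<Sum>j<r. m j :: nat)"
proof -
  have "(\<Sum>j<r. m j) = \<Sum>(m ` {..<r})" using assms by (simp add: sum.reindex)
  then show ?thesis using sum_card_lower_bound[of "m ` {..<r}" r] card_image[OF assms] by simp
qed

lemma jt_sum_too_small: "(\<Sum>j<r. m j) < (\<Sum>i<r. i) \<Longrightarrow> jt r h m = 0"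
  using sum_inj_lower_bound[of m r] jt_not_inj[of m r] by force

text \<open>Adjoining a missing \<open>a < k\<close> would give \<open>r + 1\<close> distinct
  naturals with a total below \<open>0 + ... + r\<close>.\<close>

lemma inj_image_contains_initial:
  fixes m :: "nat \<Rightarrow> nat"
  assumes inj: "inj_on m {..<r}" and le: "(\<Sum>j<r. m j) + k \<le> r + (\<Sum>i<r. i)" and a: "a < k"
  shows "a \<in> m ` {..<r}"
proof (rule ccontr)
  let ?S = "m ` {..<r}"
  assume na: "a \<notin> ?S"
  have "(\<Sum>i<Suc r. i) \<le> \<Sum>(insert a ?S)"
    using na card_image[OF inj] by (intro sum_card_lower_bound) auto
  also have "\<dots> = a + (\<Sum>j<r. m j)" using na inj by (simp add: sum.reindex)
  finally show False using le a by simp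
qed

lemma sum_upd:
  fixes m :: "nat \<Rightarrow> 'a::comm_monoid_add"
  assumes "j < r"
  shows "(\<Sum>i<r. (m(j := v)) i) = v + (\<Sum>i\<in>{..<r} - {j}. m i)"
  using assms by (subst sum.remove[of _ j]) (auto intro!: sum.cong)

text \<open>\<open>h\<close> and \<open>p\<close> are values of the complete symmetric functions and of the power sums.\<close>
locale newton_pair =
  fixes h p :: "nat \<Rightarrow> 'a::field_char_0"
  assumes h_0: "h 0 = 1"
    and newton: "\<And>k. of_nat k * h k = (\<Sum>l = 1..k. p l * h (k - l))"
begin

text \<open>Newton's identity at index \<open>m - i\<close>. Terms with \<open>k > m - i\<close>
  vanish, so one bound \<open>K\<close> can be shared by all rows.\<close>

lemma shifted_coeff_newton:
  assumes "m \<le> K"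
  shows "(of_nat m - of_nat i) * shifted_coeff h m i =
    (\<Sum>k = 1..K. p k * (if k \<le> m then shifted_coeff h (m - k) i else 0))"
proof (cases "i \<le> m")
  case True
  have "(\<Sum>k = 1..K. p k * (if k \<le> m then shifted_coeff h (m - k) i else 0)) =
        (\<Sum>k = 1..m - i. p k * h (m - i - k))"
    using True assms by (intro sum.mono_neutral_cong_right) (auto simp: shifted_coeff_def add.commute)
  then show ?thesis using newton[of "m - i"] True by (simp add: shifted_coeff_def of_nat_diff)
next
  case False
  then show ?thesis by (auto simp: shifted_coeff_def intro!: sum.neutral)
qed

text \<open>Euler's identity for the degree: removing \<open>k\<close> from one entry of \<open>m\<close> in all possible ways is
  the operator \<open>k\<partial>/\<partial>p\<^sub>k\<close>.\<close>
lemma jt_degree: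
  assumes K: "\<And>j. j < r \<Longrightarrow> m j \<le> K"
  shows "(of_nat (\<Sum>j<r. m j) - of_nat (\<Sum>i<r. i)) * jt r h m =
    (\<Sum>k = 1..K. p k * (\<Sum>j<r. if k \<le> m j then jt r h (m(j := m j - k)) else 0))"
proof -
  define R where "R \<sigma> j = (\<Prod>i\<in>{..<r} - {j}. shifted_coeff h (m i) (\<sigma> i))" for \<sigma> j
  have split: "(\<Prod>i<r. shifted_coeff h ((m(j := v)) i) (\<sigma> i)) = shifted_coeff h v (\<sigma> j) * R \<sigma> j"
    if "j < r" for \<sigma> j v
    using that unfolding R_def by (subst prod.remove[of _ j]) (auto intro!: prod.cong)
  have split': "(\<Prod>i<r. shifted_coeff h (m i) (\<sigma> i)) = shifted_coeff h (m j) (\<sigma> j) * R \<sigma> j"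
    if "j < r" for \<sigma> j
    using that unfolding R_def by (subst prod.remove[of _ j]) auto
  have "(\<Sum>k = 1..K. p k * (\<Sum>j<r. if k \<le> m j then jt r h (m(j := m j - k)) else 0)) =
    (\<Sum>k = 1..K. \<Sum>j<r. \<Sum>\<sigma> | \<sigma> permutes {..<r}. signof \<sigma> *
       (p k * (if k \<le> m j then shifted_coeff h (m j - k) (\<sigma> j) else 0) * R \<sigma> j))"
    unfolding sum_distrib_left jt_leibniz
    by (intro sum.cong refl) (auto simp: split sum_distrib_left mult_ac simp del: fun_upd_apply)
  also have "\<dots> = (\<Sum>j<r. \<Sum>\<sigma> | \<sigma> permutes {..<r}. \<Sum>k = 1..K. signof \<sigma> *
       (p k * (if k \<le> m j then shifted_coeff h (m j - k) (\<sigma> j) else 0) * R \<sigma> j))"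
    by (subst sum.swap, rule sum.cong[OF refl], rule sum.swap)
  also have "\<dots> = (\<Sum>j<r. \<Sum>\<sigma> | \<sigma> permutes {..<r}. signof \<sigma> *
       ((of_nat (m j) - of_nat (\<sigma> j)) * shifted_coeff h (m j) (\<sigma> j) * R \<sigma> j))"
    by (intro sum.cong refl)
      (simp only: lessThan_iff shifted_coeff_newton[OF K] sum_distrib_left[symmetric] sum_distrib_right[symmetric])
  also have "\<dots> = (\<Sum>\<sigma> | \<sigma> permutes {..<r}. \<Sum>j<r. signof \<sigma> *
       ((of_nat (m j) - of_nat (\<sigma> j)) * (\<Prod>i<r. shifted_coeff h (m i) (\<sigma> i))))"
    by (subst sum.swap, intro sum.cong refl, subst split') (auto simp: mult.assoc)
  also have "\<dots> = (\<Sum>\<sigma> | \<sigma> permutes {..<r}. (of_nat (\<Sum>j<r. m j) - of_nat (\<Sum>i<r. i)) *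
       (signof \<sigma> * (\<Prod>i<r. shifted_coeff h (m i) (\<sigma> i))))"
  proof (intro sum.cong refl)
    \<comment> \<open>The column indices \<sigma> j always have the same total, so the summed
      weights \<open>m j - \<sigma> j\<close> do not depend on \<sigma>.\<close>
    fix \<sigma> assume "\<sigma> \<in> {\<sigma>. \<sigma> permutes {..<r}}"
    then have "(\<Sum>j<r. \<sigma> j) = (\<Sum>i<r. i)"
      using sum.permute[of \<sigma> "{..<r}" "\<lambda>i. i"] by (simp add: o_def)
    then have "(\<Sum>j<r. of_nat (m j) - of_nat (\<sigma> j) :: 'a) = of_nat (\<Sum>j<r. m j) - of_nat (\<Sum>i<r. i)"
      by (metis of_nat_sum sum_subtractf)
    then show "(\<Sum>j<r. signof \<sigma> * ((of_nat (m j) - of_nat (\<sigma> j)) * (\<Prod>i<r. shifted_coeff h (m i) (\<sigma> i))))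
      = (of_nat (\<Sum>j<r. m j) - of_nat (\<Sum>i<r. i)) * (signof \<sigma> * (\<Prod>i<r. shifted_coeff h (m i) (\<sigma> i)))"
      by (simp only: sum_distrib_left[symmetric] sum_distrib_right[symmetric] mult.left_commute)
  qed
  also have "\<dots> = (of_nat (\<Sum>j<r. m j) - of_nat (\<Sum>i<r. i)) * jt r h m"
    by (simp only: jt_leibniz sum_distrib_left)
  finally show ?thesis ..
qed

end

section \<open>Tuples of fixed total, border strips, and the recursion for sums of squares\<close>

definition tuples :: "nat \<Rightarrow> nat \<Rightarrow> (nat \<Rightarrow> nat) set" where
  "tuples r N = {m \<in> extensional {..<r}. (\<Sum>j<r. m j) = N}"

lemma finite_tuples: "finite (tuples r N)"
proof (rule finite_subset)
  show "tuples r N \<subseteq> {..<r} \<rightarrow>\<^sub>E {..N}"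
    by (auto simp: tuples_def PiE_def Pi_iff intro!: member_le_sum)
qed (auto intro: finite_PiE)

lemma sum_upd_diff:
  fixes m :: "nat \<Rightarrow> nat"
  assumes "j < r" "k \<le> m j"
  shows "(\<Sum>i<r. (m(j := m j - k)) i) = (\<Sum>i<r. m i) - k"
  using assms sum_upd[of j r m "m j - k"] sum.remove[of "{..<r}" j m] by simp

lemma sum_upd_add:
  fixes m :: "nat \<Rightarrow> nat"
  assumes "j < r"
  shows "(\<Sum>i<r. (m(j := m j + k)) i) = (\<Sum>i<r. m i) + k"
  using assms sum_upd[of j r m "m j + k"] sum.remove[of "{..<r}" j m] by simp

text \<open>If \<open>m a = m b\<close>, only the increments at \<open>a\<close> and
  \<open>b\<close> can contribute, and these two tuples differ by a transposition, so their
  determinants cancel.\<close>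

lemma sum_jt_add_not_inj:
  assumes "\<not> inj_on m {..<r}"
  shows "(\<Sum>j<r. jt r h (m(j := m j + k))) = 0"
proof -
  from assms obtain a b where ab: "a < r" "b < r" "a \<noteq> b" "m a = m b"
    by (auto simp: inj_on_def)
  have "(\<Sum>j<r. jt r h (m(j := m j + k))) = (\<Sum>j\<in>{a, b}. jt r h (m(j := m j + k)))"
  proof (rule sum.mono_neutral_right; (intro ballI)?)
    fix j assume j: "j \<in> {..<r} - {a, b}"
    show "jt r h (m(j := m j + k)) = 0"
    proof (rule jt_not_inj)
      show "\<not> inj_on (m(j := m j + k)) {..<r}"
        using j ab inj_onD[of "m(j := m j + k)" "{..<r}" a b] by auto
    qed
  qed (use ab in auto)
  also have "\<dots> = jt r h (m(a := m a + k)) + jt r h (m(b := m b + k))"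
    using ab by simp
  also have "m(b := m b + k) = m(a := m a + k) \<circ> transpose a b"
    using ab by (auto simp: transpose_def)
  also have "jt r h (m(a := m a + k) \<circ> transpose a b) = - jt r h (m(a := m a + k))"
    using ab by (subst jt_permute) (auto intro!: permutes_swap_id simp: sign_swap_id)
  finally show ?thesis by (simp only: add.right_inverse)
qed

text \<open>Every value below \<open>k\<close> is attained exactly once. This count supplies the
  factor \<open>k\<close> of the terms with \<open>l = k\<close> in the border-strip rule.\<close>

lemma card_initial_preimage:
  fixes m :: "nat \<Rightarrow> nat"
  assumes "inj_on m {..<r}" "(\<Sum>j<r. m j) + k \<le> r + (\<Sum>i<r. i)"
  shows "card {i. i < r \<and> m i < k} = k"
proof -
  have "bij_betw m {i. i < r \<and> m i < k} {..<k}"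
    using assms(1) inj_image_contains_initial[OF assms]
    by (fastforce simp: bij_betw_def inj_on_def)
  then show ?thesis by (simp add: bij_betw_same_card)
qed

context newton_pair
begin

text \<open>Murnaghan--Nakayama rule. The bound says that the partition encoded by \<open>m\<close> has at least
  \<open>k\<close> zero parts, so that \<open>r\<close> rows suffice to add a border strip of size \<open>k\<close>.
  Applying \<open>jt_degree\<close> to the right-hand side reduces the claim to smaller \<open>m\<close>, up to the terms \<open>B l i\<close>
  below, which come from the non-commutation of \<open>\<partial>/\<partial>p\<^sub>l\<close> with \<open>p\<^sub>k\<close> and cancel unless \<open>l = k\<close>.\<close>
lemma jt_mult_power_sum:
  assumes "0 < k" "(\<Sum>j<r. m j) + k \<le> r + (\<Sum>i<r. i)"
  shows "p k * jt r h m = (\<Sum>j<r. jt r h (m(j := m j + k)))"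
  using assms(2)
proof (induction "\<Sum>j<r. m j" arbitrary: m rule: less_induct)
  case less
  show ?case
  proof (cases "inj_on m {..<r}")
    case False
    show ?thesis by (simp only: sum_jt_add_not_inj[OF False] jt_not_inj[OF False] mult_zero_right)
  next
    case inj: True
    define N where "N = (\<Sum>j<r. m j)"
    define T where "T = (\<Sum>i<r. i)"
    define K where "K = N + k"
    have NT: "T \<le> N" using sum_inj_lower_bound[OF inj] by (simp add: N_def T_def)
    have mN: "m j \<le> N" if "j < r" for j unfolding N_def using that by (intro member_le_sum) auto
    \<comment> \<open>\<open>t l i j\<close> adds \<open>k\<close> at \<open>j\<close> and then
      takes \<open>l\<close> off at \<open>i\<close>. \<open>A\<close> takes \<open>l\<close> off
      without adding; \<open>B\<close> collects the removals at \<open>i\<close> that become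
      possible only after adding \<open>k\<close> there.\<close>
    define t where "t l i j = (if l \<le> (m(j := m j + k)) i
        then jt r h ((m(j := m j + k))(i := (m(j := m j + k)) i - l)) else 0)" for l i j
    define A where "A l i = (if l \<le> m i then jt r h (m(i := m i - l)) else 0)" for l i
    define B where "B l i = (if m i < l \<and> l \<le> m i + k then jt r h (m(i := m i + k - l)) else 0)" for l i
    have t_sum: "(\<Sum>j<r. t l i j) = p k * A l i + B l i" if l: "1 \<le> l" and i: "i < r" for l i
    proof (cases "l \<le> m i")
      case True
      have s: "(\<Sum>j<r. (m(i := m i - l)) j) = N - l"
        using sum_upd_diff[of i r l m] i True by (simp add: N_def)
      have "l \<le> N" using True mN[OF i] by simp
      have "t l i j = jt r h ((m(i := m i - l))(j := (m(i := m i - l)) j + k))" if "j < r" for j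
        using True by (cases "i = j") (auto simp: t_def fun_upd_twist)
      then have "(\<Sum>j<r. t l i j) = (\<Sum>j<r. jt r h ((m(i := m i - l))(j := (m(i := m i - l)) j + k)))"
        by simp
      \<comment> \<open>Induction hypothesis for \<open>m\<close> with \<open>l\<close> taken off
        entry \<open>i\<close>, which has a smaller total.\<close>
      also have "\<dots> = p k * jt r h (m(i := m i - l))"
        using less.prems l \<open>l \<le> N\<close> by (intro less.hyps[symmetric]) (simp_all only: s, simp_all add: N_def)
      finally show ?thesis using True by (simp add: A_def B_def)
    next
      case False
      then have "(\<Sum>j<r. t l i j) = (\<Sum>j\<in>{i}. t l i j)"
        using i by (intro sum.mono_neutral_right) (auto simp: t_def)
      then show ?thesis using False by (simp add: A_def B_def t_def)
    qed
    have B_sum: "(\<Sum>i<r. B l i) = (if l = k then of_nat k * jt r h m else 0)" for l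
    proof (cases "l = k")
      case True
      have "(\<Sum>i<r. B l i) = (\<Sum>i\<in>{i. i < r \<and> m i < k}. jt r h m)"
        using True by (intro sum.mono_neutral_cong_right) (auto simp: B_def)
      then show ?thesis using True card_initial_preimage[OF inj less.prems] by simp
    next
      case False
      have "B l i = 0" if i: "i < r" for i
      proof (cases "m i < l \<and> l \<le> m i + k")
        case True
        \<comment> \<open>A value below \<open>k\<close> is already taken, and by another index
          since \<open>l\<close> differs from \<open>k\<close>: two rows coincide.\<close>
        then have "m i + k - l < k" by auto
        from inj_image_contains_initial[OF inj less.prems this]
        obtain b where b: "b < r" "m b = m i + k - l" by auto
        moreover have "b \<noteq> i" using b(2) True False by auto
        ultimately show ?thesis using i by (simp add: B_def jt_not_inj_upd)
      qed (auto simp: B_def)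
      then show ?thesis using False by simp
    qed
    have deg: "(of_nat (N + k) - of_nat T) * jt r h (m(j := m j + k)) = (\<Sum>l = 1..K. p l * (\<Sum>i<r. t l i j))"
      if j: "j < r" for j
    proof -
      have "(m(j := m j + k)) i \<le> K" if "i < r" for i
        using mN[OF that] by (auto simp: K_def)
      from jt_degree[of r "m(j := m j + k)" K, OF this] show ?thesis
        unfolding t_def sum_upd_add[OF j, of m k] N_def T_def .
    qed
    have "(of_nat (N + k) - of_nat T) * (\<Sum>j<r. jt r h (m(j := m j + k))) =
      (\<Sum>j<r. \<Sum>l = 1..K. p l * (\<Sum>i<r. t l i j))"
      unfolding sum_distrib_left using deg by (intro sum.cong) (auto simp: sum_distrib_left)
    also have "\<dots> = (\<Sum>l = 1..K. p l * (\<Sum>i<r. \<Sum>j<r. t l i j))"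
      by (subst sum.swap, intro sum.cong refl, subst sum.swap) (simp add: sum_distrib_left)
    also have "\<dots> = (\<Sum>l = 1..K. p k * (p l * (\<Sum>i<r. A l i)) + (if l = k then p k * (of_nat k * jt r h m) else 0))"
    proof (rule sum.cong[OF refl])
      fix l assume "l \<in> {1..K}"
      then have "(\<Sum>i<r. \<Sum>j<r. t l i j) = p k * (\<Sum>i<r. A l i) + (\<Sum>i<r. B l i)"
        by (simp add: t_sum sum.distrib sum_distrib_left)
      then show "p l * (\<Sum>i<r. \<Sum>j<r. t l i j) =
          p k * (p l * (\<Sum>i<r. A l i)) + (if l = k then p k * (of_nat k * jt r h m) else 0)"
        by (simp add: B_sum algebra_simps)
    qed
    also have "\<dots> = p k * (\<Sum>l = 1..K. p l * (\<Sum>i<r. A l i)) + p k * (of_nat k * jt r h m)"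
      using \<open>0 < k\<close> by (simp add: sum.distrib sum_distrib_left K_def)
    also have "(\<Sum>l = 1..K. p l * (\<Sum>i<r. A l i)) = (of_nat N - of_nat T) * jt r h m"
      unfolding A_def N_def T_def using mN by (intro jt_degree[symmetric]) (auto simp: K_def N_def intro: trans_le_add1)
    also have "p k * ((of_nat N - of_nat T) * jt r h m) + p k * (of_nat k * jt r h m) =
        (of_nat (N + k) - of_nat T) * (p k * jt r h m)"
      by (simp add: algebra_simps)
    finally have "(of_nat (N + k) - of_nat T) * (\<Sum>j<r. jt r h (m(j := m j + k))) =
        (of_nat (N + k) - of_nat T) * (p k * jt r h m)" .
    \<comment> \<open>Distinct entries force \<open>T \<le> N\<close>, so this factor is a positive
      integer and can be cancelled in characteristic zero.\<close>
    moreover have "(of_nat (N + k) :: 'a) - of_nat T \<noteq> 0"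
      using NT \<open>0 < k\<close> by (simp flip: of_nat_add)
    ultimately show ?thesis by (simp only: mult_cancel_left) simp
  qed
qed

text \<open>\<open>T\<close> is the total of the staircase \<open>0, ..., r - 1\<close>, so
  injective tuples of total \<open>n + T\<close> encode partitions of \<open>n\<close>. By
  \<open>n \<le> r\<close>, a tuple of total \<open>n - k + T\<close> meets the bound in
  \<open>jt_mult_power_sum\<close>.\<close>

lemma sum_jt_square_recursion:
  assumes "n \<le> r"
  defines "T \<equiv> (\<Sum>i<r. i)"
  shows "of_nat n * (\<Sum>m\<in>tuples r (n + T). (jt r h m)\<^sup>2) =
    (\<Sum>k = 1..n. (p k)\<^sup>2 * (\<Sum>m\<in>tuples r (n - k + T). (jt r h m)\<^sup>2))"
proof -
  define lower where "lower k j m = (if k \<le> m j then jt r h (m(j := m j - k)) else 0)" for k j m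
  have mle: "m j \<le> n + T" if "m \<in> tuples r (n + T)" "j < r" for m j
    using that member_le_sum[of j "{..<r}" m] by (simp add: tuples_def)
  have strip: "(\<Sum>j<r. \<Sum>m\<in>tuples r (n + T). jt r h m * lower k j m) =
      p k * (\<Sum>m\<in>tuples r (n - k + T). (jt r h m)\<^sup>2)" if k: "1 \<le> k" "k \<le> n" for k
  proof -
    have "(\<Sum>m\<in>tuples r (n + T). jt r h m * lower k j m) =
        (\<Sum>m\<in>tuples r (n - k + T). jt r h (m(j := m j + k)) * jt r h m)" if j: "j < r" for j
    proof -
      have "(\<Sum>m\<in>tuples r (n + T). jt r h m * lower k j m) =
          (\<Sum>m\<in>{m \<in> tuples r (n + T). k \<le> m j}. jt r h m * jt r h (m(j := m j - k)))"
        by (intro sum.mono_neutral_cong_right) (auto simp: finite_tuples lower_def)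
      also have "\<dots> = (\<Sum>m\<in>tuples r (n - k + T). jt r h (m(j := m j + k)) * jt r h m)"
      proof (rule sum.reindex_bij_witness[where i = "\<lambda>m. m(j := m j + k)" and j = "\<lambda>m. m(j := m j - k)"])
        fix m assume m: "m \<in> {m \<in> tuples r (n + T). k \<le> m j}"
        then show "m(j := m j - k) \<in> tuples r (n - k + T)"
          using j k sum_upd_diff[of j r k m] by (auto simp: tuples_def extensional_def)
      next
        fix m assume m: "m \<in> tuples r (n - k + T)"
        then show "m(j := m j + k) \<in> {m \<in> tuples r (n + T). k \<le> m j}"
          using j k sum_upd_add[of j r m k] by (auto simp: tuples_def extensional_def)
      qed auto
      finally show ?thesis .
    qed
    then have "(\<Sum>j<r. \<Sum>m\<in>tuples r (n + T). jt r h m * lower k j m) =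
        (\<Sum>j<r. \<Sum>m\<in>tuples r (n - k + T). jt r h (m(j := m j + k)) * jt r h m)"
      by simp
    also have "\<dots> = (\<Sum>m\<in>tuples r (n - k + T). (\<Sum>j<r. jt r h (m(j := m j + k))) * jt r h m)"
      by (subst sum.swap) (simp add: sum_distrib_right)
    also have "\<dots> = (\<Sum>m\<in>tuples r (n - k + T). (p k * jt r h m) * jt r h m)"
      using k assms by (intro sum.cong refl, subst jt_mult_power_sum) (auto simp: tuples_def)
    finally show ?thesis by (simp add: sum_distrib_left power2_eq_square mult.assoc)
  qed
  have "of_nat n * (\<Sum>m\<in>tuples r (n + T). (jt r h m)\<^sup>2) =
      (\<Sum>m\<in>tuples r (n + T). jt r h m * (of_nat n * jt r h m))"
    by (simp add: sum_distrib_left power2_eq_square mult_ac)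
  also have "\<dots> = (\<Sum>m\<in>tuples r (n + T). jt r h m * (\<Sum>k = 1..n + T. p k * (\<Sum>j<r. lower k j m)))"
  proof (rule sum.cong[OF refl])
    fix m assume m: "m \<in> tuples r (n + T)"
    have "(of_nat (n + T) - of_nat T) * jt r h m = (\<Sum>k = 1..n + T. p k * (\<Sum>j<r. lower k j m))"
      using jt_degree[of r m "n + T", OF mle[OF m]] m
      unfolding lower_def tuples_def T_def by (simp del: of_nat_sum)
    then show "jt r h m * (of_nat n * jt r h m) = jt r h m * (\<Sum>k = 1..n + T. p k * (\<Sum>j<r. lower k j m))"
      by simp
  qed
  also have "\<dots> = (\<Sum>m\<in>tuples r (n + T). jt r h m * (\<Sum>k = 1..n. p k * (\<Sum>j<r. lower k j m)))"
  proof (rule sum.cong[OF refl], rule arg_cong2[OF refl, where f = "(*)"], rule sum.mono_neutral_right; (intro ballI)?)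
    \<comment> \<open>For \<open>k > n\<close> the remaining total falls below that of the
      staircase.\<close>
    fix m k assume m: "m \<in> tuples r (n + T)" and k: "k \<in> {1..n + T} - {1..n}"
    have "lower k j m = 0" if "j < r" for j
      using m k that sum_upd_diff[of j r k m]
      by (auto simp: lower_def tuples_def T_def intro!: jt_sum_too_small)
    then show "p k * (\<Sum>j<r. lower k j m) = 0" by simp
  qed auto
  also have "\<dots> = (\<Sum>k = 1..n. p k * (\<Sum>j<r. \<Sum>m\<in>tuples r (n + T). jt r h m * lower k j m))"
    unfolding sum_distrib_left
    by (subst sum.swap, intro sum.cong refl, subst sum.swap) (simp add: mult_ac)
  also have "\<dots> = (\<Sum>k = 1..n. (p k)\<^sup>2 * (\<Sum>m\<in>tuples r (n - k + T). (jt r h m)\<^sup>2))"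
    by (intro sum.cong refl) (simp add: strip power2_eq_square mult.assoc)
  finally show ?thesis .
qed

end

subsection \<open>Tuples and partitions\<close>

text \<open>The parts are read from last to first, so a weakly decreasing list gives strictly
  increasing beta numbers.\<close>

definition beta :: "nat list \<Rightarrow> nat \<Rightarrow> nat" where
  "beta lam j = lam ! (length lam - 1 - j) + j"

lemma shifted_parts_beta: "shifted_parts lam = map (beta lam) [0..<length lam]"
  by (simp add: shifted_parts_def beta_def)

text \<open>Trailing zeros bring all partitions with at most \<open>r\<close> parts to length
  \<open>r\<close>, so that their determinants share one size.\<close>

definition weak_partitions :: "nat \<Rightarrow> nat \<Rightarrow> nat list set" where
  "weak_partitions r n = {lam. length lam = r \<and> sorted_wrt (\<ge>) lam \<and> sum_list lam = n}"

lemma beta_less: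
  assumes "sorted_wrt (\<ge>) lam" "i < j" "j < length lam"
  shows "beta lam i < beta lam j"
  using assms sorted_wrt_nth_less[of "(\<ge>)" lam "length lam - 1 - j" "length lam - 1 - i"]
  by (simp add: beta_def add_le_less_mono)

lemma strict_mono_on_beta: "sorted_wrt (\<ge>) lam \<Longrightarrow> strict_mono_on {..<length lam} (beta lam)"
  by (auto simp: strict_mono_on_def beta_less)

lemma inj_on_beta: "sorted_wrt (\<ge>) lam \<Longrightarrow> inj_on (beta lam) {..<length lam}"
  by (intro strict_mono_on_imp_inj_on strict_mono_on_beta)

lemma sum_beta: "(\<Sum>j<length lam. beta lam j) = sum_list lam + (\<Sum>i<length lam. i)"
proof -
  have "(\<Sum>j<length lam. lam ! (length lam - Suc j)) = (\<Sum>j<length lam. lam ! j)"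
    by (rule sum.nat_diff_reindex)
  then show ?thesis by (simp add: beta_def sum.distrib sum_list_sum_nth lessThan_atLeast0)
qed

text \<open>A strictly increasing list is determined by its set of entries, and subtracting the
  staircase recovers the parts.\<close>

lemma beta_eqI:
  assumes "sorted_wrt (\<ge>) lam" "sorted_wrt (\<ge>) lam'" "length lam = r" "length lam' = r"
    and "beta lam ` {..<r} = beta lam' ` {..<r}"
  shows "lam = lam'"
proof -
  have "map (beta lam) [0..<r] = map (beta lam') [0..<r]"
    using assms by (intro strict_sorted_equal) (auto simp: sorted_wrt_iff_nth_less beta_less lessThan_atLeast0)
  then have eq: "beta lam j = beta lam' j" if "j < r" for j
    using that by (auto simp: list_eq_iff_nth_eq)
  show ?thesis
  proof (rule nth_equalityI)
    fix i assume "i < length lam"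
    then show "lam ! i = lam' ! i" using eq[of "r - 1 - i"] assms by (simp add: beta_def)
  qed (use assms in simp)
qed

text \<open>Sort the values and subtract the staircase: distinct naturals have gaps of at least one,
  so the differences stay ordered.\<close>

lemma weak_partition_of_inj:
  assumes inj: "inj_on m {..<r}"
  obtains lam where "length lam = r" "sorted_wrt (\<ge>) lam" "beta lam ` {..<r} = m ` {..<r}"
proof -
  define xs where "xs = sorted_list_of_set (m ` {..<r})"
  have len: "length xs = r" using card_image[OF inj] by (simp add: xs_def)
  have set: "set xs = m ` {..<r}" by (simp add: xs_def)
  have "xs ! i < xs ! j" if "i < j" "j < r" for i j
    using that len strict_sorted_list_of_set[of "m ` {..<r}"] by (simp add: xs_def sorted_wrt_iff_nth_less)
  then have gap: "xs ! i + d \<le> xs ! (i + d)" if "i + d < r" for i d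
    using that by (induction d) (auto simp: less_Suc_eq_le Suc_le_eq dest: order_le_less_trans)
  have gap': "xs ! i + (j - i) \<le> xs ! j" if "i \<le> j" "j < r" for i j
    using gap[of i "j - i"] that by simp
  define lam where "lam = map (\<lambda>i. xs ! (r - 1 - i) - (r - 1 - i)) [0..<r]"
  \<comment> \<open>The gap estimate from index 0 gives \<open>j \<le> xs ! j\<close>, so the
    truncated subtraction is exact.\<close>
  have beta: "beta lam j = xs ! j" if "j < r" for j
    using gap'[of 0 j] that by (simp add: beta_def lam_def)
  show ?thesis
  proof
    show "length lam = r" by (simp add: lam_def)
    show "sorted_wrt (\<ge>) lam"
      unfolding sorted_wrt_iff_nth_less
    proof (intro allI impI)
      fix i j assume "i < j" "j < length lam"
      then show "lam ! j \<le> lam ! i"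
        using gap'[of "r - 1 - j" "r - 1 - i"] unfolding lam_def by simp linarith
    qed
    have "beta lam ` {..<r} = (!) xs ` {..<r}" using beta by (intro image_cong) auto
    also have "\<dots> = m ` {..<r}" using len set by (auto simp: set_conv_nth lessThan_def)
    finally show "beta lam ` {..<r} = m ` {..<r}" .
  qed
qed

text \<open>An injective tuple amounts to its set of values together with the order in which they
  are listed.\<close>

lemma bij_betw_permutation_weak_partition_tuples:
  defines "T r \<equiv> (\<Sum>i<r. i)"
  shows "bij_betw (\<lambda>(\<sigma>, lam). restrict (beta lam \<circ> \<sigma>) {..<r})
    ({\<sigma>. \<sigma> permutes {..<r}} \<times> weak_partitions r n) {m \<in> tuples r (n + T r). inj_on m {..<r}}"
    (is "bij_betw ?f ?A ?B")
proof (rule bij_betwI')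
  fix x y assume xy: "x \<in> ?A" "y \<in> ?A"
  obtain \<sigma> lam \<sigma>' lam' where eq: "x = (\<sigma>, lam)" "y = (\<sigma>', lam')" by (cases x, cases y)
  with xy have *: "\<sigma> permutes {..<r}" "\<sigma>' permutes {..<r}" "sorted_wrt (\<ge>) lam" "sorted_wrt (\<ge>) lam'"
    "length lam = r" "length lam' = r" by (auto simp: weak_partitions_def)
  show "?f x = ?f y \<longleftrightarrow> x = y"
  proof
    assume "?f x = ?f y"
    then have pt: "beta lam (\<sigma> j) = beta lam' (\<sigma>' j)" if "j < r" for j
      using that by (auto simp: eq fun_eq_iff restrict_def split: if_splits)
    have "beta lam ` \<sigma> ` {..<r} = beta lam' ` \<sigma>' ` {..<r}"
      using pt by (auto simp: image_image)
    then have "lam = lam'" using * by (intro beta_eqI) (auto simp: permutes_image)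
    moreover have "\<sigma> j = \<sigma>' j" for j
    proof (cases "j < r")
      case True
      then show ?thesis using pt[OF True] inj_on_beta[OF *(3)] * \<open>lam = lam'\<close>
          permutes_in_image[of \<sigma> "{..<r}" j] permutes_in_image[of \<sigma>' "{..<r}" j]
        by (auto dest!: inj_onD)
    qed (use * in \<open>auto simp: permutes_def\<close>)
    ultimately show "x = y" by (auto simp: eq)
  qed simp
next
  fix x assume x: "x \<in> ?A"
  obtain \<sigma> lam where eq: "x = (\<sigma>, lam)" by (cases x)
  with x have *: "\<sigma> permutes {..<r}" "sorted_wrt (\<ge>) lam" "length lam = r" "sum_list lam = n"
    by (auto simp: weak_partitions_def)
  have "inj_on (beta lam \<circ> \<sigma>) {..<r}"
    using * inj_on_beta[OF *(2)] by (intro comp_inj_on) (auto simp: permutes_image permutes_inj_on)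
  moreover have "(\<Sum>j<r. beta lam (\<sigma> j)) = n + T r"
    using sum.permute[OF *(1), of "beta lam"] sum_beta[of lam] * by (simp add: T_def o_def)
  ultimately show "?f x \<in> ?B"
    by (auto simp: eq tuples_def inj_on_def)
next
  fix m assume "m \<in> ?B"
  then have m: "m \<in> extensional {..<r}" "(\<Sum>j<r. m j) = n + T r" and inj: "inj_on m {..<r}"
    by (auto simp: tuples_def)
  obtain lam where lam: "length lam = r" "sorted_wrt (\<ge>) lam" "beta lam ` {..<r} = m ` {..<r}"
    using weak_partition_of_inj[OF inj] .
  have bb: "bij_betw (beta lam) {..<r} (m ` {..<r})"
    using inj_on_beta[OF lam(2)] lam by (simp add: bij_betw_def)
  \<comment> \<open>\<sigma> j is the rank of \<open>m j\<close> among the values; outside the index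
    range a permutation of \<open>{..<r}\<close> has to be the identity.\<close>
  define \<sigma> where "\<sigma> j = (if j < r then the_inv_into {..<r} (beta lam) (m j) else j)" for j
  have "bij_betw (the_inv_into {..<r} (beta lam) \<circ> m) {..<r} {..<r}"
    using bij_betw_the_inv_into[OF bb] inj by (intro bij_betw_trans[of m _ "m ` {..<r}"]) (auto simp: bij_betw_def)
  then have "bij_betw \<sigma> {..<r} {..<r}"
    by (rule bij_betw_cong[THEN iffD1, rotated]) (simp add: \<sigma>_def)
  then have \<sigma>: "\<sigma> permutes {..<r}" by (rule bij_imp_permutes) (simp add: \<sigma>_def)
  have beta_\<sigma>: "beta lam (\<sigma> j) = m j" if "j < r" for j
    using that f_the_inv_into_f_bij_betw[OF bb] by (simp add: \<sigma>_def)
  have "(\<Sum>j<r. beta lam j) = (\<Sum>j<r. m j)"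
    using sum.permute[OF \<sigma>, of "beta lam"] beta_\<sigma> by simp
  then have "lam \<in> weak_partitions r n"
    using lam m sum_beta[of lam] by (simp add: weak_partitions_def T_def)
  moreover have "m = restrict (beta lam \<circ> \<sigma>) {..<r}"
    using m(1) beta_\<sigma> by (intro extensionalityI[of _ "{..<r}"]) auto
  ultimately show "\<exists>x\<in>?A. m = ?f x" using \<sigma> by (intro bexI[of _ "(\<sigma>, lam)"]) auto
qed

text \<open>Tuples with a repetition contribute zero. Reordering only changes the sign, which
  squaring removes, so each weak partition is counted \<open>fact r\<close> times.\<close>

lemma sum_tuples_jt_square:
  "(\<Sum>m\<in>tuples r (n + (\<Sum>i<r. i)). (jt r h m)\<^sup>2) =
     fact r * (\<Sum>lam\<in>weak_partitions r n. (jt r h (beta lam))\<^sup>2)"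
proof -
  let ?T = "\<Sum>i<r. i"
  have "(\<Sum>m\<in>tuples r (n + ?T). (jt r h m)\<^sup>2) =
      (\<Sum>m\<in>{m \<in> tuples r (n + ?T). inj_on m {..<r}}. (jt r h m)\<^sup>2)"
    by (rule sum.mono_neutral_right) (auto simp: finite_tuples jt_not_inj)
  also have "\<dots> = (\<Sum>(\<sigma>, lam)\<in>{\<sigma>. \<sigma> permutes {..<r}} \<times> weak_partitions r n.
      (jt r h (restrict (beta lam \<circ> \<sigma>) {..<r}))\<^sup>2)"
    by (subst sum.reindex_bij_betw[OF bij_betw_permutation_weak_partition_tuples, symmetric])
      (simp add: case_prod_unfold)
  also have "\<dots> = (\<Sum>(\<sigma>, lam)\<in>{\<sigma>. \<sigma> permutes {..<r}} \<times> weak_partitions r n. (jt r h (beta lam))\<^sup>2)"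
  proof (intro sum.cong refl, clarify)
    fix \<sigma> lam assume \<sigma>: "\<sigma> permutes {..<r}"
    have "jt r h (restrict (beta lam \<circ> \<sigma>) {..<r}) = jt r h (beta lam \<circ> \<sigma>)"
      by (rule jt_cong) simp
    then show "(jt r h (restrict (beta lam \<circ> \<sigma>) {..<r}))\<^sup>2 = (jt r h (beta lam))\<^sup>2"
      using jt_permute[OF \<sigma>, of h "beta lam"] by (auto simp: power_mult_distrib sign_def)
  qed
  also have "\<dots> = fact r * (\<Sum>lam\<in>weak_partitions r n. (jt r h (beta lam))\<^sup>2)"
    by (simp add: sum.cartesian_product[symmetric] card_permutations[of "{..<r}" r])
  finally show ?thesis .
qed

subsection \<open>Special determinants\<close>

lemma det_first_row_unit:
  fixes f :: "nat \<times> nat \<Rightarrow> 'a::comm_ring_1"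
  assumes "f (0, 0) = 1" "\<And>i. 0 < i \<Longrightarrow> i \<le> r \<Longrightarrow> f (0, i) = 0"
  shows "det (mat (Suc r) (Suc r) f) = det (mat r r (\<lambda>(j, i). f (Suc j, Suc i)))"
proof -
  let ?A = "mat (Suc r) (Suc r) f"
  have "det ?A = (\<Sum>i<Suc r. ?A $$ (0, i) * cofactor ?A 0 i)"
    by (rule laplace_expansion_row) auto
  also have "\<dots> = (\<Sum>i\<in>{0}. ?A $$ (0, i) * cofactor ?A 0 i)"
    using assms(2) by (intro sum.mono_neutral_right) auto
  also have "\<dots> = det (mat_delete ?A 0 0)"
    using assms(1) by (simp add: cofactor_def)
  also have "mat_delete ?A 0 0 = mat r r (\<lambda>(j, i). f (Suc j, Suc i))"
    by (intro eq_matI) (auto simp: mat_delete_def)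
  finally show ?thesis .
qed

text \<open>The new zero part has beta number 0, hence gives the first row
  \<open>1, 0, ..., 0\<close>. All other beta numbers go up by one, which the shift of the column
  index undoes.\<close>

lemma jt_beta_append_zero:
  assumes "h 0 = 1"
  shows "jt (Suc (length lam)) h (beta (lam @ [0])) = jt (length lam) h (beta lam)"
proof -
  have "jt (Suc (length lam)) h (beta (lam @ [0])) =
      det (mat (length lam) (length lam) (\<lambda>(j, i). shifted_coeff h (beta (lam @ [0]) (Suc j)) (Suc i)))"
    unfolding jt_def using assms by (subst det_first_row_unit) (auto simp: beta_def shifted_coeff_def)
  also have "\<dots> = jt (length lam) h (beta lam)"
    unfolding jt_def
    by (intro arg_cong[where f = det] eq_matI) (auto simp: beta_def shifted_coeff_def nth_append)
  finally show ?thesis .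
qed

lemma jt_beta_append_zeros:
  assumes "h 0 = 1"
  shows "jt (length lam + d) h (beta (lam @ replicate d 0)) = jt (length lam) h (beta lam)"
proof (induction d)
  case (Suc d)
  then show ?case using jt_beta_append_zero[of h "lam @ replicate d 0"] assms
    by (simp add: replicate_append_same)
qed simp

lemma jt_beta_zeros: "h 0 = 1 \<Longrightarrow> jt r h (beta (replicate r 0)) = 1"
  using jt_beta_append_zeros[of h "[]" r] by (simp add: jt_def)

lemma det_scale_rows:
  fixes a :: "nat \<Rightarrow> 'a::comm_ring_1"
  shows "det (mat r r (\<lambda>(j, i). a j * f j i)) = (\<Prod>j<r. a j) * det (mat r r (\<lambda>(j, i). f j i))"
proof -
  have "(\<Prod>j = 0..<r. mat r r (\<lambda>(j, i). a j * f j i) $$ (j, \<sigma> j)) =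
      (\<Prod>j<r. a j) * (\<Prod>j = 0..<r. mat r r (\<lambda>(j, i). f j i) $$ (j, \<sigma> j))"
    if "\<sigma> permutes {0..<r}" for \<sigma>
    using permutes_in_image[OF that] by (simp add: lessThan_atLeast0 flip: prod.distrib)
  then show ?thesis
    by (subst (1 2) det_def'[of _ r]) (auto simp: sum_distrib_left mult_ac intro!: sum.cong)
qed

text \<open>Falling factorial. Being monic of degree \<open>i\<close> in \<open>x\<close>, it can
  replace \<open>x ^ i\<close> in a Vandermonde determinant.\<close>

definition ffact :: "nat \<Rightarrow> 'a::comm_ring_1 \<Rightarrow> 'a" where
  "ffact i x = (\<Prod>l<i. x - of_nat l)"

lemma det_ffact:
  "det (mat r r (\<lambda>(j, i). ffact i (x j))) = (\<Prod>j<r. \<Prod>i<j. x j - x i :: 'a::comm_ring_1)"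
proof (induction r arbitrary: x)
  case (Suc r)
  define M where "M = mat (Suc r) (Suc r) (\<lambda>(j, i). ffact i (x j))"
  \<comment> \<open>Column operation \<open>C\<^sub>i\<^sub>+\<^sub>1 := C\<^sub>i\<^sub>+\<^sub>1 - (x 0 - i) C\<^sub>i\<close>, which turns \<open>ffact (i + 1) (x j)\<close> into \<open>(x j - x 0) ffact i (x j)\<close>.\<close>
  define L where "L = mat (Suc r) (Suc r) (\<lambda>(a, b). if a = b then 1 else if Suc a = b then - (x 0 - of_nat a) else 0)"
  have MC: "M \<in> carrier_mat (Suc r) (Suc r)" and LC: "L \<in> carrier_mat (Suc r) (Suc r)"
    by (auto simp: M_def L_def)
  have "det L = prod_list (diag_mat L)"
    by (rule det_upper_triangular[OF _ LC]) (auto simp: upper_triangular_def L_def)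
  also have "\<dots> = 1"
    by (simp add: prod_list_diag_prod L_def)
  finally have "det M = det (M * L)" by (simp add: det_mult[OF MC LC])
  also have "M * L = mat (Suc r) (Suc r)
      (\<lambda>(j, i). case i of 0 \<Rightarrow> 1 | Suc i \<Rightarrow> (x j - x 0) * ffact i (x j))" (is "_ = mat _ _ ?f")
  proof (rule eq_matI)
    fix j i assume ij: "j < dim_row (mat (Suc r) (Suc r) ?f)" "i < dim_col (mat (Suc r) (Suc r) ?f)"
    have "(M * L) $$ (j, i) = (\<Sum>a<Suc r. ffact a (x j) *
        (if a = i then 1 else if Suc a = i then - (x 0 - of_nat a) else 0))"
      using ij by (simp add: M_def L_def scalar_prod_def lessThan_atLeast0)
    also have "\<dots> = ?f (j, i)"
    proof (cases i)
      case 0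
      then show ?thesis by (simp add: ffact_def if_distrib cong: if_cong)
    next
      case (Suc i')
      have "(\<Sum>a<Suc r. ffact a (x j) * (if a = i then 1 else if Suc a = i then - (x 0 - of_nat a) else 0)) =
          (\<Sum>a\<in>{i', i}. ffact a (x j) * (if a = i then 1 else if Suc a = i then - (x 0 - of_nat a) else 0))"
        using ij Suc by (intro sum.mono_neutral_right) auto
      also have "\<dots> = (x j - x 0) * ffact i' (x j)"
        using Suc by (simp add: ffact_def algebra_simps)
      finally show ?thesis using Suc by simp
    qed
    finally show "(M * L) $$ (j, i) = mat (Suc r) (Suc r) ?f $$ (j, i)" using ij by simp
  qed (auto simp: M_def L_def)
  also have "det (mat (Suc r) (Suc r) ?f) =
      det (mat r r (\<lambda>(j, i). (x (Suc j) - x 0) * ffact i (x (Suc j))))"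
    by (subst det_first_row_unit) (auto split: nat.splits)
  also have "\<dots> = (\<Prod>j<r. x (Suc j) - x 0) * det (mat r r (\<lambda>(j, i). ffact i (x (Suc j))))"
    by (rule det_scale_rows)
  also have "\<dots> = (\<Prod>j<r. x (Suc j) - x 0) * (\<Prod>j<r. \<Prod>i<j. x (Suc j) - x (Suc i))"
    by (simp add: Suc.IH)
  also have "\<dots> = (\<Prod>j<Suc r. \<Prod>i<j. x j - x i)"
    by (simp add: prod.lessThan_Suc_shift prod.distrib del: prod.lessThan_Suc)
  finally show ?case by (simp add: M_def)
qed simp

text \<open>Pulling \<open>1 / fact (m j)\<close> out of row \<open>j\<close> turns
  \<open>1 / fact (m j - i)\<close> into a falling factorial, which vanishes for
  \<open>i > m j\<close> just as \<open>shifted_coeff\<close> does.\<close>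

lemma jt_inverse_fact:
  "jt r (\<lambda>k. inverse (fact k)) m =
     of_int (\<Prod>j<r. \<Prod>i<j. int (m j) - int (m i)) / (\<Prod>j<r. fact (m j) :: 'a::field_char_0)"
proof -
  have *: "inverse (fact k) * ffact i (of_nat k) = shifted_coeff (\<lambda>k. inverse (fact k) :: 'a) k i" for k i
  proof (cases "i \<le> k")
    case True
    have "fact (k - i) * ffact i (of_nat k) = (fact k :: 'a)"
      using True
    proof (induction i)
      case (Suc i)
      have "(fact (k - i) :: 'a) = of_nat (k - i) * fact (k - Suc i)"
        using Suc.prems by (subst fact_reduce) (auto simp: Suc_diff_Suc)
      with Suc show ?case by (simp add: ffact_def of_nat_diff mult_ac)
    qed (simp add: ffact_def)
    then show ?thesis using True by (simp add: shifted_coeff_def field_simps)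
  next
    case False
    then have "ffact i (of_nat k :: 'a) = 0" by (auto simp: ffact_def intro!: bexI[of _ k])
    with False show ?thesis by (simp add: shifted_coeff_def)
  qed
  have "jt r (\<lambda>k. inverse (fact k)) m = det (mat r r (\<lambda>(j, i). inverse (fact (m j)) * ffact i (of_nat (m j) :: 'a)))"
    unfolding jt_def * ..
  also have "\<dots> = (\<Prod>j<r. inverse (fact (m j))) * (\<Prod>j<r. \<Prod>i<j. of_nat (m j) - of_nat (m i))"
    by (simp add: det_scale_rows det_ffact[of r "\<lambda>j. of_nat (m j)"])
  finally show ?thesis by (simp add: prod_inversef[unfolded o_def] divide_inverse mult.commute)
qed

subsection \<open>Standard tableaux and Frobenius' formula\<close>

definition corners :: "nat list \<Rightarrow> nat set" where
  "corners lam = {i. i < length lam \<and> 0 < lam ! i \<and> (Suc i < length lam \<longrightarrow> lam ! Suc i < lam ! i)}"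

text \<open>The list keeps its length even if a part drops to zero, so the recursion stays within
  determinants of one size.\<close>

definition remove_cell :: "nat list \<Rightarrow> nat \<Rightarrow> nat list" where
  "remove_cell lam i = lam[i := lam ! i - 1]"

lemma length_remove_cell [simp]: "length (remove_cell lam i) = length lam"
  by (simp add: remove_cell_def)

lemma young_cells_remove_cell:
  assumes "i < length lam" "0 < lam ! i"
  shows "young_cells (remove_cell lam i) = young_cells lam - {(i, lam ! i - 1)}"
  using assms by (auto simp: young_cells_def remove_cell_def nth_list_update split: if_splits)

lemma sum_list_remove_cell:
  assumes "i < length lam" "0 < lam ! i"
  shows "Suc (sum_list (remove_cell lam i)) = sum_list lam"
  using assms elem_le_sum_list[of i lam] by (simp add: remove_cell_def sum_list_update)

lemma sorted_remove_cell:
  assumes "sorted_wrt (\<ge>) lam" "i \<in> corners lam"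
  shows "sorted_wrt (\<ge>) (remove_cell lam i)"
  unfolding sorted_wrt_iff_nth_less
proof (intro allI impI)
  fix a b assume ab: "a < b" "b < length (remove_cell lam i)"
  then have le: "lam ! b \<le> lam ! a" using assms(1) by (auto simp: sorted_wrt_iff_nth_less)
  have "lam ! b < lam ! a" if "a = i"
  proof -
    have "lam ! b \<le> lam ! Suc i"
      using assms(1) ab that by (cases "b = Suc i") (auto simp: sorted_wrt_iff_nth_less)
    then show ?thesis using assms(2) ab that by (auto simp: corners_def)
  qed
  then show "remove_cell lam i ! b \<le> remove_cell lam i ! a"
    using le ab by (cases "a = i"; cases "b = i") (auto simp: remove_cell_def nth_list_update)
qed

lemma finite_young_cells: "finite (young_cells lam)"
proof (rule finite_subset)
  show "young_cells lam \<subseteq> (SIGMA i:{..<length lam}. {..<lam ! i})"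
    by (auto simp: young_cells_def)
qed auto

lemma finite_standard_tableaux: "finite (standard_tableaux lam)"
proof (rule finite_subset)
  show "standard_tableaux lam \<subseteq> young_cells lam \<rightarrow>\<^sub>E {1..sum_list lam}"
    by (auto simp: standard_tableaux_def PiE_def bij_betw_def)
qed (auto intro: finite_PiE finite_young_cells)

lemma num_syt_sum_zero:
  assumes "sum_list lam = 0"
  shows "num_syt lam = 1"
proof -
  have "young_cells lam = {}" using assms by (auto simp: young_cells_def) (metis nth_mem not_less_zero)
  then have "standard_tableaux lam = {\<lambda>_. undefined}"
    using assms by (auto simp: standard_tableaux_def bij_betw_def)
  then show ?thesis by (simp add: num_syt_def)
qed

text \<open>The bijection erases the largest entry and puts it back. A corner has no right or lower
  neighbour, so the restored entry violates no inequality. The erased cell becomes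
  \<open>undefined\<close>, as extensionality on the smaller diagram requires.\<close>

lemma card_standard_tableaux_max_at:
  assumes lam: "sorted_wrt (\<ge>) lam" and i: "i \<in> corners lam"
  shows "card {T \<in> standard_tableaux lam. T (i, lam ! i - 1) = sum_list lam} = num_syt (remove_cell lam i)"
proof -
  let ?c = "(i, lam ! i - 1)" and ?n = "sum_list lam" and ?mu = "remove_cell lam i"
  have i': "i < length lam" "0 < lam ! i" using i by (auto simp: corners_def)
  have cells: "young_cells ?mu = young_cells lam - {?c}" and c: "?c \<in> young_cells lam"
    using i' young_cells_remove_cell[OF i'] by (auto simp: young_cells_def)
  have n: "?n = Suc (sum_list ?mu)" using sum_list_remove_cell[OF i'] by simp
  have right: "(i, Suc (lam ! i - 1)) \<notin> young_cells lam"
    using i' by (auto simp: young_cells_def)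
  have below: "(Suc i, lam ! i - 1) \<notin> young_cells lam"
    using i by (auto simp: young_cells_def corners_def)
  have left_closed: "(a, b) \<in> young_cells lam" if "(a, Suc b) \<in> young_cells lam" for a b
    using that by (auto simp: young_cells_def)
  have up_closed: "(a, b) \<in> young_cells lam" if "(Suc a, b) \<in> young_cells lam" for a b
    using that lam by (fastforce simp: young_cells_def sorted_wrt_iff_nth_less)
  have "bij_betw (\<lambda>T. T(?c := undefined))
     {T \<in> standard_tableaux lam. T ?c = ?n} (standard_tableaux ?mu)"
  proof (rule bij_betw_byWitness[where f' = "\<lambda>T. T(?c := ?n)"])
    show "\<forall>T\<in>{T \<in> standard_tableaux lam. T ?c = ?n}. (T(?c := undefined))(?c := ?n) = T"
      by auto
    show "\<forall>T\<in>standard_tableaux ?mu. (T(?c := ?n))(?c := undefined) = T"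
      by (auto simp: standard_tableaux_def extensional_def cells)
    show "(\<lambda>T. T(?c := undefined)) ` {T \<in> standard_tableaux lam. T ?c = ?n} \<subseteq> standard_tableaux ?mu"
    proof clarify
      fix T assume T: "T \<in> standard_tableaux lam" "T ?c = ?n"
      then have b: "bij_betw T (young_cells lam) {1..?n}" by (simp add: standard_tableaux_def)
      have "bij_betw T (young_cells lam - {?c}) ({1..?n} - {?n})"
        using bij_betw_DiffI[OF b, of "{?c}" "{?n}"] T(2) c n by (simp add: bij_betw_def)
      moreover have "{1..?n} - {?n} = {1..sum_list ?mu}" using n by auto
      ultimately have "bij_betw T (young_cells ?mu) {1..sum_list ?mu}" by (simp add: cells)
      then have "bij_betw (T(?c := undefined)) (young_cells ?mu) {1..sum_list ?mu}"
        by (rule bij_betw_cong[THEN iffD1, rotated]) (auto simp: cells)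
      then show "T(?c := undefined) \<in> standard_tableaux ?mu"
        using T(1) right below by (auto simp: standard_tableaux_def cells extensional_def)
    qed
    show "(\<lambda>T. T(?c := ?n)) ` standard_tableaux ?mu \<subseteq> {T \<in> standard_tableaux lam. T ?c = ?n}"
    proof clarify
      fix T assume T: "T \<in> standard_tableaux ?mu"
      then have b: "bij_betw T (young_cells ?mu) {1..sum_list ?mu}" by (simp add: standard_tableaux_def)
      have small: "T d < ?n" if "d \<in> young_cells lam" "d \<noteq> ?c" for d
        using that bij_betwE[OF b] by (auto simp: cells n less_Suc_eq_le)
      have "bij_betw (T(?c := ?n)) (young_cells ?mu) {1..sum_list ?mu}"
        using b by (rule bij_betw_cong[THEN iffD1, rotated]) (auto simp: cells)
      then have "bij_betw (T(?c := ?n)) (young_cells ?mu \<union> {?c}) ({1..sum_list ?mu} \<union> {?n})"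
        by (rule bij_betw_combine) (auto simp: n bij_betw_def)
      moreover have "young_cells ?mu \<union> {?c} = young_cells lam" using c by (auto simp: cells)
      moreover have "{1..sum_list ?mu} \<union> {?n} = {1..?n}" using n by auto
      ultimately have "bij_betw (T(?c := ?n)) (young_cells lam) {1..?n}" by simp
      moreover have "(T(?c := ?n)) (a, b) < (T(?c := ?n)) (a, Suc b)" if ab: "(a, Suc b) \<in> young_cells lam" for a b
      proof -
        have ne: "(a, b) \<noteq> ?c" using ab right by auto
        then show ?thesis
          using ab small[OF left_closed[OF ab] ne] T
          by (cases "(a, Suc b) = ?c") (auto simp: standard_tableaux_def cells)
      qed
      moreover have "(T(?c := ?n)) (a, b) < (T(?c := ?n)) (Suc a, b)" if ab: "(Suc a, b) \<in> young_cells lam" for a b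
      proof -
        have ne: "(a, b) \<noteq> ?c" using ab below by auto
        then show ?thesis
          using ab small[OF up_closed[OF ab] ne] T
          by (cases "(Suc a, b) = ?c") (auto simp: standard_tableaux_def cells)
      qed
      moreover have "T(?c := ?n) \<in> extensional (young_cells lam)"
        using T c by (auto simp: standard_tableaux_def cells extensional_def)
      ultimately show "T(?c := ?n) \<in> standard_tableaux lam \<and> (T(?c := ?n)) ?c = ?n"
        unfolding standard_tableaux_def by auto
    qed
  qed
  then show ?thesis by (simp add: num_syt_def bij_betw_same_card)
qed

text \<open>A neighbour to the right or below would have to carry a larger entry.\<close>

lemma standard_tableau_max_at_corner:
  assumes T: "T \<in> standard_tableaux lam" and pos: "0 < sum_list lam"
  shows "\<exists>i\<in>corners lam. T (i, lam ! i - 1) = sum_list lam"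
proof -
  have b: "bij_betw T (young_cells lam) {1..sum_list lam}" using T by (simp add: standard_tableaux_def)
  then have "sum_list lam \<in> T ` young_cells lam" using pos by (auto simp: bij_betw_def)
  then obtain i j where ij: "(i, j) \<in> young_cells lam" "T (i, j) = sum_list lam" by force
  have max: "T d \<le> T (i, j)" if "d \<in> young_cells lam" for d
    using bij_betwE[OF b] that ij by auto
  have r: "(i, Suc j) \<notin> young_cells lam" and d: "(Suc i, j) \<notin> young_cells lam"
    using T max[of "(i, Suc j)"] max[of "(Suc i, j)"] by (auto simp: standard_tableaux_def not_le[symmetric])
  have "i < length lam" "j = lam ! i - 1" "0 < lam ! i" using ij(1) r by (auto simp: young_cells_def)
  moreover from this have "i \<in> corners lam" using d by (auto simp: corners_def young_cells_def)
  ultimately show ?thesis using ij by auto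
qed

lemma num_syt_recursion:
  assumes lam: "sorted_wrt (\<ge>) lam" and pos: "0 < sum_list lam"
  shows "num_syt lam = (\<Sum>i\<in>corners lam. num_syt (remove_cell lam i))"
proof -
  let ?S = "\<lambda>i. {T \<in> standard_tableaux lam. T (i, lam ! i - 1) = sum_list lam}"
  have "standard_tableaux lam = (\<Union>i\<in>corners lam. ?S i)"
    using standard_tableau_max_at_corner[OF _ pos] by auto
  then have "num_syt lam = card (\<Union>i\<in>corners lam. ?S i)" by (simp add: num_syt_def)
  also have "\<dots> = (\<Sum>i\<in>corners lam. card (?S i))"
  proof (rule card_UN_disjoint)
    show "\<forall>i\<in>corners lam. \<forall>j\<in>corners lam. i \<noteq> j \<longrightarrow> ?S i \<inter> ?S j = {}"
    proof (intro ballI impI equals0I)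
      fix i j T assume ij: "i \<in> corners lam" "j \<in> corners lam" "i \<noteq> j" and T: "T \<in> ?S i \<inter> ?S j"
      then have "inj_on T (young_cells lam)" "T (i, lam ! i - 1) = T (j, lam ! j - 1)"
        by (auto simp: standard_tableaux_def bij_betw_def)
      then have "(i, lam ! i - 1) = (j, lam ! j - 1)"
        using ij by (intro inj_onD[of T]) (auto simp: corners_def young_cells_def)
      then show False using ij by simp
    qed
  qed (auto simp: corners_def finite_standard_tableaux)
  also have "\<dots> = (\<Sum>i\<in>corners lam. num_syt (remove_cell lam i))"
    by (intro sum.cong refl card_standard_tableaux_max_at lam)
  finally show ?thesis .
qed

text \<open>The exponential specialization: the generating function is \<open>exp t\<close>, so only
  the first power sum is nonzero.\<close>

lemma newton_pair_inverse_fact: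
  "newton_pair (\<lambda>k. inverse (fact k) :: 'a::field_char_0) (\<lambda>k. if k = 1 then 1 else 0)"
proof
  fix k
  show "of_nat k * inverse (fact k) =
      (\<Sum>l = 1..k. (if l = 1 then 1 else 0) * inverse (fact (k - l)) :: 'a)"
  proof (cases k)
    case (Suc k')
    have "(\<Sum>l = 1..k. (if l = 1 then 1 else 0) * inverse (fact (k - l)) :: 'a) =
        (\<Sum>l\<in>{1}. inverse (fact (k - l)))"
      using Suc by (intro sum.mono_neutral_cong_right) auto
    then show ?thesis using Suc by (simp add: field_simps del: of_nat_Suc)
  qed simp
qed simp

lemma beta_remove_cell:
  assumes "j < length lam" "k < length lam" "0 < lam ! (length lam - 1 - j)"
  shows "beta (remove_cell lam (length lam - 1 - j)) k = ((beta lam)(j := beta lam j - 1)) k"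
  using assms by (auto simp: beta_def remove_cell_def nth_list_update)

text \<open>Up to the factorial, both sides obey the same recursion over corners. For the
  determinant it is \<open>jt_degree\<close> with only the first power sum present; lowering a
  positive beta number in a row that is no corner makes two of them collide.\<close>

lemma frobenius_num_syt:
  assumes "sorted_wrt (\<ge>) lam"
  shows "of_nat (num_syt lam) =
    fact (sum_list lam) * jt (length lam) (\<lambda>k. inverse (fact k) :: 'a::field_char_0) (beta lam)"
  using assms
proof (induction "sum_list lam" arbitrary: lam)
  case 0
  then have "lam = replicate (length lam) 0" by (auto simp: list_eq_iff_nth_eq)
  moreover have "jt r (\<lambda>k. inverse (fact k) :: 'a) (beta (replicate r 0)) = 1" for r
    by (rule jt_beta_zeros) simp
  ultimately have "jt (length lam) (\<lambda>k. inverse (fact k) :: 'a) (beta lam) = 1" by metis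
  then show ?case using 0 by (simp add: num_syt_sum_zero del: sum_list_eq_0_iff flip: 0(1))
next
  case (Suc n)
  interpret newton_pair "\<lambda>k. inverse (fact k) :: 'a" "\<lambda>k. if k = 1 then 1 else 0"
    by (rule newton_pair_inverse_fact)
  define r where "r = length lam"
  let ?D = "\<lambda>lam. jt r (\<lambda>k. inverse (fact k) :: 'a) (beta lam)"
  \<comment> \<open>The \<open>Suc\<close> ensures \<open>1 \<le> K\<close>, so the only surviving
    term \<open>k = 1\<close> lies in the range of summation.\<close>
  define K where "K = Suc (\<Sum>j<r. beta lam j)"
  have K: "beta lam j \<le> K" if "j < r" for j
    unfolding K_def using that member_le_sum[of j "{..<r}" "beta lam"] by simp
  define g where "g k = (\<Sum>j<r. if k \<le> beta lam j
    then jt r (\<lambda>k. inverse (fact k) :: 'a) ((beta lam)(j := beta lam j - k)) else 0)" for k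
  have "of_nat (Suc n) * ?D lam = (\<Sum>k = 1..K. (if k = 1 then 1 else 0) * g k)"
    using jt_degree[of r "beta lam" K, OF K] sum_beta[of lam] Suc.hyps(2)
    by (simp add: r_def g_def del: of_nat_sum of_nat_Suc)
  also have "\<dots> = (\<Sum>k\<in>{1}. g k)"
    by (intro sum.mono_neutral_cong_right) (auto simp: K_def)
  also have "\<dots> = g 1" by simp
  also have "\<dots> = (\<Sum>j<r. if r - 1 - j \<in> corners lam then ?D (remove_cell lam (r - 1 - j)) else 0)"
    unfolding g_def
  proof (intro sum.cong refl)
    fix j assume "j \<in> {..<r}"
    then have j: "j < r" by simp
    show "(if 1 \<le> beta lam j then jt r (\<lambda>k. inverse (fact k) :: 'a) ((beta lam)(j := beta lam j - 1)) else 0) =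
        (if r - 1 - j \<in> corners lam then ?D (remove_cell lam (r - 1 - j)) else 0)"
    proof (cases "r - 1 - j \<in> corners lam")
      case True
      then have "0 < lam ! (r - 1 - j)" by (simp add: corners_def)
      then have "?D (remove_cell lam (r - 1 - j)) = jt r (\<lambda>k. inverse (fact k)) ((beta lam)(j := beta lam j - 1))"
        using j beta_remove_cell[of j lam] unfolding r_def by (intro jt_cong) auto
      moreover have "1 \<le> beta lam j" using \<open>0 < lam ! (r - 1 - j)\<close> by (simp add: beta_def r_def)
      ultimately show ?thesis using True by simp
    next
      case False
      have "jt r (\<lambda>k. inverse (fact k) :: 'a) ((beta lam)(j := beta lam j - 1)) = 0" if ge: "1 \<le> beta lam j"
      proof (cases j)
        case 0
        then have "r - 1 - j \<in> corners lam" using ge j by (auto simp: corners_def beta_def r_def)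
        then show ?thesis using False by simp
      next
        case (Suc b)
        then have *: "length lam - Suc b = Suc (length lam - Suc j)" "length lam - Suc j < length lam"
          using j by (auto simp: r_def)
        then have "lam ! (length lam - Suc b) \<le> lam ! (length lam - Suc j)"
          using Suc.prems j Suc by (auto simp: sorted_wrt_iff_nth_less r_def)
        moreover have "\<not> lam ! (length lam - Suc b) < lam ! (length lam - Suc j)"
          using False * j by (auto simp: corners_def r_def)
        \<comment> \<open>The row below is equally long, so lowering beta number \<open>j\<close>
          hits beta number \<open>b\<close>.\<close>
        ultimately have "beta lam b = beta lam j - 1" using Suc by (simp add: beta_def)
        then show ?thesis using j Suc by (intro jt_not_inj_upd[of b]) auto
      qed
      then show ?thesis using False by simp
    qed
  qed
  also have "\<dots> = (\<Sum>i<r. if i \<in> corners lam then ?D (remove_cell lam i) else 0)"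
    using sum.nat_diff_reindex[of "\<lambda>i. if i \<in> corners lam then ?D (remove_cell lam i) else 0" r]
    by (simp only: diff_Suc_eq_diff_pred)
  also have "\<dots> = (\<Sum>i\<in>corners lam. ?D (remove_cell lam i))"
    by (intro sum.mono_neutral_cong_right) (auto simp: corners_def r_def)
  finally have rec: "of_nat (Suc n) * ?D lam = (\<Sum>i\<in>corners lam. ?D (remove_cell lam i))" .
  have "of_nat (num_syt lam) = (\<Sum>i\<in>corners lam. of_nat (num_syt (remove_cell lam i)) :: 'a)"
    using Suc by (subst num_syt_recursion) auto
  also have "\<dots> = (\<Sum>i\<in>corners lam. fact n * ?D (remove_cell lam i))"
  proof (intro sum.cong refl)
    fix i assume i: "i \<in> corners lam"
    then have "Suc (sum_list (remove_cell lam i)) = sum_list lam"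
      by (intro sum_list_remove_cell) (auto simp: corners_def)
    then have "sum_list (remove_cell lam i) = n" using Suc.hyps(2) by simp
    then show "of_nat (num_syt (remove_cell lam i)) = fact n * ?D (remove_cell lam i)"
      using Suc.hyps(1)[of "remove_cell lam i"] sorted_remove_cell[OF Suc.prems i] by (simp add: r_def)
  qed
  also have "\<dots> = fact (Suc n) * ?D lam"
    by (simp add: sum_distrib_left[symmetric] rec[symmetric] algebra_simps)
  finally show ?case using Suc.hyps(2) by (simp add: r_def)
qed

subsection \<open>Appell sequences\<close>

text \<open>The series \<open>H = exp (x t + g)\<close> satisfies \<open>H' = (x + g') H\<close>.
  Comparing coefficients gives Newton's identities, the power sums being \<open>k\<close> times the
  coefficients of \<open>x t + g\<close>.\<close>

lemma newton_pair_appell: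
  fixes g :: "'a::field_char_0 fps"
  assumes "fps_nth g 0 = 0"
  shows "newton_pair (\<lambda>k. poly (appell (fps_exp_of g) k) x / fact k)
    (\<lambda>k. of_nat k * fps_nth g k + (if k = 1 then x else 0))"
proof -
  define F where "F = fps_exp_of g"
  define H where "H = F * fps_exp x"
  have nth_H: "poly (appell F k) x / fact k = fps_nth H k" for k
  proof -
    have "poly (appell F k) x / fact k = (\<Sum>j\<le>k. fps_nth F j * (x ^ (k - j) / fact (k - j)))"
      unfolding appell_def poly_sum sum_divide_distrib
      by (intro sum.cong refl) (auto simp: poly_monom binomial_fact field_simps)
    then show ?thesis
      by (simp add: H_def fps_mult_nth fps_exp_def atLeast0AtMost)
  qed
  have "fps_deriv F = F * fps_deriv g"
    unfolding F_def fps_exp_of_def using fps_compose_deriv[OF assms, of "fps_exp 1"] by simp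
  then have deriv: "fps_deriv H = (fps_const x + fps_deriv g) * H"
    by (simp add: H_def algebra_simps)
  have "of_nat k * fps_nth H k =
      (\<Sum>l = 1..k. (of_nat l * fps_nth g l + (if l = 1 then x else 0)) * fps_nth H (k - l))" for k
  proof (cases k)
    case (Suc k')
    have "of_nat k * fps_nth H k = fps_nth (fps_deriv H) k'" using Suc by simp
    also have "\<dots> = (\<Sum>l = 0..k'. fps_nth (fps_const x + fps_deriv g) l * fps_nth H (k' - l))"
      by (simp only: deriv fps_mult_nth)
    also have "\<dots> = (\<Sum>l = Suc 0..Suc k'. (of_nat l * fps_nth g l + (if l = 1 then x else 0)) * fps_nth H (k - l))"
      unfolding sum.shift_bounds_cl_Suc_ivl using Suc by (intro sum.cong refl) (auto simp: algebra_simps)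
    finally show ?thesis using Suc by simp
  qed simp
  moreover have "fps_nth H 0 = 1" by (simp add: H_def F_def fps_exp_of_def)
  ultimately show ?thesis unfolding F_def[symmetric] nth_H by unfold_locales
qed

lemma pderiv_appell: "pderiv (appell f (Suc m)) = smult (of_nat (Suc m)) (appell f m)"
proof (rule poly_eqI)
  fix d
  have co: "coeff (appell f m) d = (if d \<le> m then of_nat (m choose (m - d)) * fact (m - d) * fps_nth f (m - d) else 0)" for m d
  proof (cases "d \<le> m")
    case True
    have "coeff (appell f m) d = (\<Sum>j\<in>{m - d}. of_nat (m choose j) * fact j * fps_nth f j)"
      unfolding appell_def coeff_sum using True by (intro sum.mono_neutral_cong_right) (auto simp: coeff_monom)
    then show ?thesis using True by simp
  next
    case False
    then show ?thesis unfolding appell_def coeff_sum by (auto simp: coeff_monom intro!: sum.neutral)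
  qed
  show "coeff (pderiv (appell f (Suc m))) d = coeff (smult (of_nat (Suc m)) (appell f m)) d"
  proof (cases "d \<le> m")
    case True
    have "Suc d * (Suc m choose Suc d) = Suc m * (m choose d)" by (rule Suc_times_binomial)
    then have "Suc d * (Suc m choose (m - d)) = Suc m * (m choose (m - d))"
      using True binomial_symmetric[of "Suc d" "Suc m"] binomial_symmetric[of d m] by simp
    then have "of_nat (Suc d) * of_nat (Suc m choose (m - d)) = (of_nat (Suc m) * of_nat (m choose (m - d)) :: 'a)"
      by (metis of_nat_mult)
    then show ?thesis using True by (simp add: coeff_pderiv co mult.assoc[symmetric] del: of_nat_Suc)
  qed (simp add: coeff_pderiv co)
qed

text \<open>Each derivative lowers the index by one, and the constant at index 0 is killed. Hence
  columns of the Wronskian are rows of \<open>jt\<close> up to factorials.\<close>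

lemma poly_pderiv_appell:
  "poly ((pderiv ^^ i) (appell f m)) x = fact m * shifted_coeff (\<lambda>k. poly (appell f k) x / fact k) m i"
proof -
  have "(pderiv ^^ i) (appell f m) = (if i \<le> m then smult (fact m / fact (m - i)) (appell f (m - i)) else 0)"
  proof (induction i)
    case (Suc i)
    show ?case
    proof (cases "i < m")
      case True
      then obtain d where d: "m - i = Suc d" "m - Suc i = d" by (metis Suc_diff_Suc)
      have "fact m / fact (Suc d) * of_nat (Suc d) = (fact m / fact d :: 'a)"
        by (simp add: field_simps del: of_nat_Suc)
      then show ?thesis using True d by (simp add: Suc pderiv_smult pderiv_appell del: of_nat_Suc fact_Suc)
    next
      case False
      then have "pderiv (appell f (m - i)) = 0" by (simp add: appell_def monom_0)
      then show ?thesis using False by (simp add: Suc pderiv_smult)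
    qed
  qed simp
  then show ?thesis by (simp add: shifted_coeff_def)
qed

lemma poly_det: "poly (det A) x = det (map_mat (\<lambda>q. poly q x) (A :: 'a::comm_ring_1 poly mat))"
proof -
  interpret comm_ring_hom "\<lambda>q. poly q x" by unfold_locales auto
  show ?thesis by simp
qed

lemma poly_wronskian_appell:
  fixes f :: "'a::field_char_0 fps" and x :: 'a
  defines "h \<equiv> (\<lambda>k. poly (appell f k) x / fact k)"
  shows "poly (wronskian (map (appell f) (shifted_parts lam))) x =
    (\<Prod>j<length lam. fact (beta lam j)) * jt (length lam) h (beta lam)"
proof -
  define r where "r = length lam"
  have "poly (wronskian (map (appell f) (shifted_parts lam))) x =
      det (mat r r (\<lambda>(i, j). fact (beta lam j) * shifted_coeff h (beta lam j) i))"
    unfolding wronskian_def poly_det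
    by (intro arg_cong[where f = det] eq_matI)
      (auto simp: shifted_parts_beta r_def h_def poly_pderiv_appell)
  \<comment> \<open>The Wronskian has the derivative order along rows, \<open>jt\<close> has it
    along columns.\<close>
  also have "\<dots> = det (mat r r (\<lambda>(j, i). fact (beta lam j) * shifted_coeff h (beta lam j) i))"
    by (subst det_transpose[of _ r, symmetric]) (auto intro!: arg_cong[where f = det] eq_matI)
  also have "\<dots> = (\<Prod>j<r. fact (beta lam j)) * jt r h (beta lam)"
    by (simp add: det_scale_rows jt_def)
  finally show ?thesis by (simp add: r_def)
qed

text \<open>In Frobenius' formula the Vandermonde product cancels the normalization of
  \<open>appell_schur\<close>, and the factorials cancel the row factors of the Wronskian.\<close>

lemma num_syt_mult_appell_schur:
  fixes x :: "'a::field_char_0"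
  assumes "sorted_wrt (\<ge>) lam"
  shows "of_nat (num_syt lam) * poly (appell_schur f lam) x =
    fact (sum_list lam) * jt (length lam) (\<lambda>k. poly (appell f k) x / fact k) (beta lam)"
proof -
  have V: "vandermonde (shifted_parts lam) = (\<Prod>j<length lam. \<Prod>i<j. int (beta lam j) - int (beta lam i))"
    unfolding vandermonde_def by (intro prod.cong) (auto simp: shifted_parts_beta)
  then have nz: "(of_int (vandermonde (shifted_parts lam)) :: 'a) \<noteq> 0"
    using beta_less[OF assms] by fastforce
  have nz': "(\<Prod>j<length lam. fact (beta lam j) :: 'a) \<noteq> 0" by simp
  have "of_nat (num_syt lam) =
      fact (sum_list lam) * (of_int (vandermonde (shifted_parts lam)) / (\<Prod>j<length lam. fact (beta lam j) :: 'a))"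
    by (simp add: frobenius_num_syt[OF assms] jt_inverse_fact V)
  then show ?thesis using nz nz'
    by (simp add: appell_schur_def poly_wronskian_appell field_simps del: prod_zero_iff)
qed

section \<open>Padding partitions with zeros, Cauchy's identity, and the expectation\<close>

lemma length_partition_le:
  assumes "lam \<in> partitions n"
  shows "length lam \<le> n"
proof -
  have "length lam \<le> sum_list lam" if "\<forall>x\<in>set lam. 0 < x" for lam :: "nat list"
    using that by (induction lam) auto
  then show ?thesis using assms by (auto simp: partitions_def)
qed

text \<open>A partition of \<open>n\<close> has at most \<open>n\<close> parts, so padding to length
  \<open>n\<close> is possible. Zeros of a weakly decreasing list stand at its end, so filtering
  them out inverts the padding.\<close>

lemma bij_betw_partitions_weak_partitions:
  "bij_betw (\<lambda>lam. lam @ replicate (n - length lam) 0) (partitions n) (weak_partitions n n)"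
proof (rule bij_betw_byWitness[where f' = "filter (\<lambda>a. 0 < a)"])
  show "\<forall>lam\<in>partitions n. filter (\<lambda>a. 0 < a) (lam @ replicate (n - length lam) 0) = lam"
    by (auto simp: partitions_def)
  have *: "filter (\<lambda>a. 0 < a) lam @ replicate (length lam - length (filter (\<lambda>a. 0 < a) lam)) 0 = lam"
    if "sorted_wrt (\<ge>) lam" for lam :: "nat list"
    using that
  proof (induction lam)
    case (Cons a lam)
    show ?case
    proof (cases "a = 0")
      case True
      then have "\<forall>b\<in>set (a # lam). b = 0" using Cons.prems by auto
      then have "a # lam = replicate (length (a # lam)) 0" "filter (\<lambda>a. 0 < a) (a # lam) = []"
        by (auto simp: replicate_length_same)
      then show ?thesis by simp
    next
      case False
      then show ?thesis using Cons by simp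
    qed
  qed simp
  then show "\<forall>lam\<in>weak_partitions n n. filter (\<lambda>a. 0 < a) lam @
      replicate (n - length (filter (\<lambda>a. 0 < a) lam)) 0 = lam"
    by (auto simp: weak_partitions_def)
  show "(\<lambda>lam. lam @ replicate (n - length lam) 0) ` partitions n \<subseteq> weak_partitions n n"
  proof clarify
    fix lam assume lam: "lam \<in> partitions n"
    have "sorted_wrt (\<ge>) (replicate d (0 :: nat))" for d by (induction d) auto
    then show "lam @ replicate (n - length lam) 0 \<in> weak_partitions n n"
      using lam length_partition_le[OF lam]
      by (auto simp: partitions_def weak_partitions_def sorted_wrt_append sum_list_replicate)
  qed
  show "filter (\<lambda>a. 0 < a) ` weak_partitions n n \<subseteq> partitions n"
  proof clarify
    fix lam assume lam: "lam \<in> weak_partitions n n"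
    have "sum_list (filter (\<lambda>a. 0 < a) lam) = sum_list lam" for lam :: "nat list"
      by (induction lam) auto
    then show "filter (\<lambda>a. 0 < a) lam \<in> partitions n"
      using lam by (auto simp: partitions_def weak_partitions_def sorted_wrt_filter)
  qed
qed

text \<open>Cauchy's identity \<open>\<Sum> s\<^sub>\<lambda>\<^sup>2 t\<^bsup>|\<lambda>|\<^esup> = exp (\<Sum> p\<^sub>k\<^sup>2 t\<^sup>k / k)\<close>, read coefficientwise.\<close>
lemma (in newton_pair) sum_weak_partitions_jt_square:
  assumes "newton_pair z (\<lambda>k. (p k)\<^sup>2)" "n \<le> r"
  shows "(\<Sum>lam\<in>weak_partitions r n. (jt r h (beta lam))\<^sup>2) = z n"
  using assms(2)
proof (induction n rule: less_induct)
  case (less n)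
  interpret z: newton_pair z "\<lambda>k. (p k)\<^sup>2" by (rule assms(1))
  show ?case
  proof (cases "n = 0")
    case True
    have "weak_partitions r 0 = {replicate r 0}"
      by (auto simp: weak_partitions_def sum_list_replicate list_eq_iff_nth_eq sorted_wrt_iff_nth_less)
    then show ?thesis using True by (simp add: jt_beta_zeros h_0 z.h_0)
  next
    case False
    \<comment> \<open>The recursion counts tuples, so every sum carries the factor
      \<open>fact r\<close>, cancelled at the end together with \<open>n\<close>.\<close>
    have "fact r * (of_nat n * (\<Sum>lam\<in>weak_partitions r n. (jt r h (beta lam))\<^sup>2)) =
        (\<Sum>k = 1..n. (p k)\<^sup>2 * (fact r * (\<Sum>lam\<in>weak_partitions r (n - k). (jt r h (beta lam))\<^sup>2)))"
      using sum_jt_square_recursion[OF less.prems] unfolding sum_tuples_jt_square by (simp only: mult.left_commute)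
    also have "\<dots> = (\<Sum>k = 1..n. (p k)\<^sup>2 * (fact r * z (n - k)))"
      using less by (intro sum.cong refl) auto
    also have "\<dots> = fact r * (\<Sum>k = 1..n. (p k)\<^sup>2 * z (n - k))"
      by (simp only: sum_distrib_left mult.left_commute)
    also have "\<dots> = fact r * (of_nat n * z n)" by (simp only: z.newton)
    finally show ?thesis using False by simp
  qed
qed

theorem theorem5p3:
  fixes c :: "nat \<Rightarrow> 'a::field_char_0" and n :: nat and x :: 'a
  defines "fA \<equiv> fps_exp_of (Abs_fps (\<lambda>k. if k = 0 then 0 else c k / fact k))"
      and "fB \<equiv> fps_exp_of (Abs_fps (\<lambda>k. if k < 2 then 0
                                        else (c k)^2 / fact (k - 1) / fact k))"
  shows "(\<Sum>lam\<in>partitions n. of_nat (num_syt lam)^2 / fact n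
            * (poly (appell_schur fA lam) x)^2)
         = poly (appell fB n) ((x + c 1)^2)"
proof -
  define h where "h = (\<lambda>k. poly (appell fA k) x / fact k)"
  define z where "z = (\<lambda>k. poly (appell fB k) ((x + c 1)\<^sup>2) / fact k)"
  define p where "p = (\<lambda>k. of_nat k * (if k = 0 then 0 else c k / fact k) + (if k = 1 then x else 0))"
  have "newton_pair h p"
    unfolding h_def p_def fA_def
    using newton_pair_appell[of "Abs_fps (\<lambda>k. if k = 0 then 0 else c k / fact k)" x] by simp
  then interpret newton_pair h p .
  \<comment> \<open>For \<open>k \<ge> 2\<close> both sides are the square of
    \<open>c k / fact (k - 1)\<close>. The logarithm of \<open>fB\<close> has no linear term; the
    square of \<open>p 1 = x + c 1\<close> enters through the argument of the polynomial
    instead.\<close>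
  have p_square: "of_nat k * (if k < 2 then 0 else (c k)^2 / fact (k - 1) / fact k) +
      (if k = 1 then (x + c 1)\<^sup>2 else 0) = (p k)\<^sup>2" for k
  proof (cases "k < 2")
    case True
    then have "k = 0 \<or> k = 1" by auto
    then show ?thesis by (auto simp: p_def add.commute)
  next
    case False
    then obtain l where "k = Suc l" "0 < l" by (cases k) auto
    then show ?thesis by (simp add: p_def power2_eq_square field_simps del: of_nat_Suc)
  qed
  have z: "newton_pair z (\<lambda>k. (p k)\<^sup>2)"
    unfolding z_def fB_def p_square[symmetric]
    using newton_pair_appell[of "Abs_fps (\<lambda>k. if k < 2 then 0 else (c k)^2 / fact (k - 1) / fact k)" "(x + c 1)\<^sup>2"]
    by simp
  have "(\<Sum>lam\<in>partitions n. of_nat (num_syt lam)^2 / fact n * (poly (appell_schur fA lam) x)^2) =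
      (\<Sum>lam\<in>partitions n. fact n * (jt n h (beta (lam @ replicate (n - length lam) 0)))\<^sup>2)"
  proof (rule sum.cong[OF refl])
    fix lam assume lam: "lam \<in> partitions n"
    have "of_nat (num_syt lam)^2 / fact n * (poly (appell_schur fA lam) x)^2 =
        (of_nat (num_syt lam) * poly (appell_schur fA lam) x)\<^sup>2 / fact n"
      by (simp add: power_mult_distrib)
    also have "\<dots> = (fact n * jt (length lam) h (beta lam))\<^sup>2 / fact n"
      using lam num_syt_mult_appell_schur[of lam fA x] by (simp add: partitions_def h_def)
    also have "\<dots> = fact n * (jt (length lam) h (beta lam))\<^sup>2"
      by (simp add: power2_eq_square)
    also have "jt (length lam) h (beta lam) = jt n h (beta (lam @ replicate (n - length lam) 0))"
      using jt_beta_append_zeros[of h lam "n - length lam"] h_0 length_partition_le[OF lam] by simp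
    finally show "of_nat (num_syt lam)^2 / fact n * (poly (appell_schur fA lam) x)^2 =
        fact n * (jt n h (beta (lam @ replicate (n - length lam) 0)))\<^sup>2" .
  qed
  also have "\<dots> = (\<Sum>lam\<in>weak_partitions n n. fact n * (jt n h (beta lam))\<^sup>2)"
    by (rule sum.reindex_bij_betw[OF bij_betw_partitions_weak_partitions])
  also have "\<dots> = fact n * z n"
    by (simp add: sum_weak_partitions_jt_square[OF z] flip: sum_distrib_left)
  finally show ?thesis by (simp add: z_def)
qed

end
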